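(* Let $n\ge1$, and for $0\le k\le n$ let $l^{n,k}$ denote the number of elements $\alpha\in T_n$ for which the orbit of $1$ under $\alpha$ has length $k$. Then: (i) $l^{n,0}=|\mathcal{IS}_{n-1}|$; (ii) the number of $\alpha\in T_n$ whose chain decomposition contains the chain $[1]$ (that is, $1\notin\operatorname{dom}(\alpha)\cup\operatorname{im}(\alpha)$) equals $|T_{n-1}|$; (iii) $l^{n,k}=[n-1]_{k-1}\cdot\bigl(L^{(n-k)}+|T_{n-k}|\bigr)$ for $1<k\le n$.
   Context: For $m\ge0$ let $\mathcal{IS}_m$ be the symmetric inverse semigroup of all partial injective maps from $\{1,\dots,m\}$ to itself (bijections between subsets $\operatorname{dom}(\alpha)$ and $\operatorname{im}(\alpha)$; the empty map, denoted $0$, is the zero element), under composition of partial maps; $\mathcal{IS}_0=\{0\}$. $T_m\subseteq\mathcal{IS}_m$ is the set of nilpotent elements, i.e. those $\alpha$ with $\alpha^r=0$ for some $r>0$; $|T_0|=1$. The graph of the action of $\alpha$ has an arrow $x\to\alpha(x)$ for each $x\in\operatorname{dom}(\alpha)$; each connected component is either a directed cycle or a directed path $a_1\to\dots\to a_k$, $k\ge1$, with $a_1\notin\operatorname{im}(\alpha)$, $a_k\notin\operatorname{dom}(\alpha)$ (a "chain" $[a_1,\dots,a_k]$; a chain of length 1 is a point outside $\operatorname{dom}(\alpha)\cup\operatorname{im}(\alpha)$). $L^{(m)}$ is the total number of chains in the chain decompositions of all elements of $T_m$; $L^{(0)}=0$. If $x\in\operatorname{dom}(\alpha)$, the orbit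 of $x$ under $\alpha$ is $\{x,\alpha(x),\alpha^2(x),\dots\}$ (of those iterates that are defined) and its length is its cardinality; if $x\notin\operatorname{dom}(\alpha)$ the orbit is empty and has length $0$. $[x]_k=x(x-1)\cdots(x-k+1)$ is the decreasing factorial, $[x]_0=1$. *)

theory Defs
  imports Main
begin

definition sym_inv_semigroup :: "nat \<Rightarrow> (nat \<rightharpoonup> nat) set" where
  "sym_inv_semigroup m =
     {\<alpha>. dom \<alpha> \<subseteq> {1..m} \<and> ran \<alpha> \<subseteq> {1..m} \<and> inj_on \<alpha> (dom \<alpha>)}"

text \<open>The zeroth power is the identity on all of the natural numbers rather than on
  \<open>{1..m}\<close>. This is immaterial below: nilpotency only uses positive powers, and an orbit is
  only formed at a point of the domain.\<close>

definition pmap_power :: "('a \<rightharpoonup> 'a) \<Rightarrow> nat \<Rightarrow> ('a \<rightharpoonup> 'a)" where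
  "pmap_power \<alpha> r = ((\<circ>\<^sub>m) \<alpha> ^^ r) Some"

definition nilpotents :: "nat \<Rightarrow> (nat \<rightharpoonup> nat) set" where
  "nilpotents m = {\<alpha> \<in> sym_inv_semigroup m. \<exists>r>0. pmap_power \<alpha> r = Map.empty}"

definition arrows :: "('a \<rightharpoonup> 'a) \<Rightarrow> ('a \<times> 'a) set" where
  "arrows \<alpha> = {(x, y). \<alpha> x = Some y}"

definition components :: "nat \<Rightarrow> (nat \<rightharpoonup> nat) \<Rightarrow> nat set set" where
  "components m \<alpha> = {1..m} // (arrows \<alpha> \<union> (arrows \<alpha>)\<inverse>)\<^sup>*"

text \<open>A chain is the list of vertices of a connected component that is a directed path. The
  order of the vertices is determined by the arrows, so every such component gives exactly
  one list.\<close>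

definition chain_decomposition :: "nat \<Rightarrow> (nat \<rightharpoonup> nat) \<Rightarrow> nat list set" where
  "chain_decomposition m \<alpha> =
     {as. as \<noteq> [] \<and> distinct as \<and> set as \<in> components m \<alpha> \<and>
          (\<forall>i. Suc i < length as \<longrightarrow> \<alpha> (as ! i) = Some (as ! Suc i)) \<and>
          hd as \<notin> ran \<alpha> \<and> last as \<notin> dom \<alpha>}"

definition total_chains :: "nat \<Rightarrow> nat" where
  "total_chains m = (\<Sum>\<alpha>\<in>nilpotents m. card (chain_decomposition m \<alpha>))"

definition orbit :: "('a \<rightharpoonup> 'a) \<Rightarrow> 'a \<Rightarrow> 'a set" where
  "orbit \<alpha> x = (if x \<in> dom \<alpha> then {y. \<exists>i. pmap_power \<alpha> i x = Some y} else {})"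

definition orbit_count :: "nat \<Rightarrow> nat \<Rightarrow> nat" where
  "orbit_count n k = card {\<alpha> \<in> nilpotents n. card (orbit \<alpha> 1) = k}"

text \<open>Truncated subtraction is harmless: for \<open>k > x\<close> the factor with \<open>i = x\<close> is zero.\<close>

definition dec_factorial :: "nat \<Rightarrow> nat \<Rightarrow> nat" where
  "dec_factorial x k = (\<Prod>i<k. x - i)"

lemma singleton_chain_iff:
  assumes "x \<in> {1..m}"
  shows "[x] \<in> chain_decomposition m \<alpha> \<longleftrightarrow> x \<notin> dom \<alpha> \<union> ran \<alpha>"
proof
  assume "[x] \<in> chain_decomposition m \<alpha>"
  then show "x \<notin> dom \<alpha> \<union> ran \<alpha>" by (simp add: chain_decomposition_def)
next
  assume x: "x \<notin> dom \<alpha> \<union> ran \<alpha>"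
  let ?R = "arrows \<alpha> \<union> (arrows \<alpha>)\<inverse>"
  have "y = x" if "(x, y) \<in> ?R\<^sup>*" for y
    using that
  proof (cases rule: converse_rtranclE)
    case (step z)
    then show ?thesis using x by (auto simp: arrows_def ran_def)
  qed simp
  then have "?R\<^sup>* `` {x} = {x}" by auto
  with assms have "{x} \<in> components m \<alpha>"
    unfolding components_def by (metis quotientI)
  with x show "[x] \<in> chain_decomposition m \<alpha>" by (simp add: chain_decomposition_def)
qed

lemma nilpotents_0: "nilpotents 0 = {Map.empty}"
proof -
  have "pmap_power Map.empty 1 = (Map.empty :: nat \<rightharpoonup> nat)"
    by (simp add: pmap_power_def)
  then show ?thesis
    by (auto simp: nilpotents_def sym_inv_semigroup_def intro: exI[of _ 1])
qed

lemma total_chains_0: "total_chains 0 = 0"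
  by (simp add: total_chains_def chain_decomposition_def components_def)

end

theory Submission
  imports Defs "HOL-Combinatorics.Permutations"
begin

text \<open>
  A partial map is replaced by the relation of its arrows. On a finite set \<open>S\<close> the partial
  injections become the relations that are single-valued in both directions, and the nilpotent
  ones become the acyclic ones (\<open>nilpotent_iff_acyclic\<close>). For \<open>x \<in> S\<close> let \<open>a(S)\<close> be the number of
  acyclic injections on \<open>S\<close> in which \<open>x\<close> has no successor. It depends only on the size of \<open>S\<close>,
  and everything is expressed by it.

  Deleting \<open>x\<close> from such a relation leaves an acyclic injection on \<open>S - {x}\<close>, together with
  either no predecessor for \<open>x\<close> or one predecessor \<open>p\<close>, which may be any point without a
  successor. A nilpotent map has exactly one chain ending at each point outside its domain
  (\<open>card_chain_decomposition\<close>), so with \<open>|S| = m + 1\<close> this gives both \<open>a(S) = |T\<^sub>m| + L\<^sup>(\<^sup>m\<^sup>)\<close> and the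
  recursion \<open>a(S) = |T\<^sub>m| + m a(S - {x})\<close>, where \<open>p\<close> takes over the part of \<open>x\<close>.

  On the other hand, every partial injection is uniquely the union of a permutation of its set
  \<open>A\<close> of periodic points and an acyclic injection on the complement. Hence
  \<open>|IS\<^sub>m|\<close> is the sum of \<open>|A|! |T\<^sub>j|\<close> over the subsets \<open>A\<close> of an \<open>m\<close>-element set, where \<open>j = m - |A|\<close>,
  and this sum is also what the recursion for \<open>a\<close> unrolls to. So
  \<open>a(S) = |IS\<^sub>m|\<close> (\<open>card_terminal\<close>), which is the first claim and at the same time identifies
  \<open>L\<^sup>(\<^sup>m\<^sup>) + |T\<^sub>m|\<close> with \<open>|IS\<^sub>m|\<close>. The second claim is the case of the deletion in which \<open>x\<close> has no
  predecessor either.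

  For the third claim, contract the arrow \<open>x \<rightarrow> y\<close> leaving \<open>x\<close>. For each of the \<open>n - 1\<close> choices of
  \<open>y\<close> this is a bijection onto all acyclic injections on \<open>S - {x}\<close>, and the path starting at \<open>x\<close>
  turns into the path starting at \<open>y\<close>, one point shorter (\<open>bij_betw_contract\<close>,
  \<open>card_reachable_contract\<close>). After \<open>k - 1\<close> contractions the start has no successor, the choices
  made contribute the decreasing factorial, and \<open>a\<close> of a set with \<open>n - k + 1\<close> points remains.
\<close>

section \<open>Partial injections as relations\<close>

definition partial_injections :: "'a set \<Rightarrow> 'a rel set" where
  "partial_injections S = {R. R \<subseteq> S \<times> S \<and> single_valued R \<and> single_valued (R\<inverse>)}"

definition acyclic_injections :: "'a set \<Rightarrow> 'a rel set" where
  "acyclic_injections S = {R \<in> partial_injections S. acyclic R}"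

lemmas injections_defs = acyclic_injections_def partial_injections_def

lemma finite_partial_injections [simp]:
  assumes "finite S" shows "finite (partial_injections S)"
  by (rule finite_subset[of _ "Pow (S \<times> S)"]) (use assms in \<open>auto simp: partial_injections_def\<close>)

lemma finite_acyclic_injections [simp]:
  assumes "finite S" shows "finite (acyclic_injections S)"
  using assms by (simp add: acyclic_injections_def)

lemma acyclic_injection_finite:
  assumes "finite S" "R \<in> acyclic_injections S" shows "finite R"
  using assms finite_subset[of R "S \<times> S"] by (auto simp: injections_defs)

lemma partial_injection_image:
  assumes "inj_on f S" "R \<in> partial_injections S"
  shows "map_prod f f ` R \<in> partial_injections (f ` S)"
proof -
  have R: "R \<subseteq> S \<times> S" "single_valued R" "single_valued (R\<inverse>)"
    using assms(2) by (auto simp: partial_injections_def)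
  have inj: "a = b" if "f a = f b" "a \<in> S" "b \<in> S" for a b
    using that assms(1) by (auto dest: inj_onD)
  have "single_valued (map_prod f f ` R)"
    using R(1,2) inj unfolding single_valued_def by (clarsimp, blast)
  moreover have "single_valued ((map_prod f f ` R)\<inverse>)"
    using R(1,3) inj unfolding single_valued_def by (clarsimp, blast)
  ultimately show ?thesis using R(1) unfolding partial_injections_def by auto
qed

lemma trancl_image_inj_on:
  assumes "inj_on f S" "R \<subseteq> S \<times> S" "(a, b) \<in> (map_prod f f ` R)\<^sup>+"
  shows "\<exists>a' b'. a = f a' \<and> b = f b' \<and> (a', b') \<in> R\<^sup>+"
  using assms(3)
proof (induction rule: trancl_induct)
  case (step b c)
  then obtain a' b' b'' c' where *: "a = f a'" "b = f b'" "(a', b') \<in> R\<^sup>+"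
    "b = f b''" "c = f c'" "(b'', c') \<in> R" by auto
  moreover have "b' \<in> S" "b'' \<in> S"
    using * assms(2) trancl_subset_Sigma[OF assms(2)] by auto
  ultimately have "b' = b''" using assms(1) by (auto dest: inj_onD)
  with * show ?case by (metis trancl.trancl_into_trancl)
qed auto

lemma acyclic_injection_image:
  assumes "inj_on f S" "R \<in> acyclic_injections S"
  shows "map_prod f f ` R \<in> acyclic_injections (f ` S)"
proof -
  have R: "R \<subseteq> S \<times> S" "acyclic R" using assms(2) by (auto simp: injections_defs)
  have "acyclic (map_prod f f ` R)"
    unfolding acyclic_def
  proof safe
    fix z assume "(z, z) \<in> (map_prod f f ` R)\<^sup>+"
    then obtain a b where "z = f a" "z = f b" "(a, b) \<in> R\<^sup>+"
      using trancl_image_inj_on[OF assms(1) R(1)] by blast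
    moreover from this have "a \<in> S" "b \<in> S" using trancl_subset_Sigma[OF R(1)] by auto
    ultimately have "(a, a) \<in> R\<^sup>+" using assms(1) by (auto dest: inj_onD)
    then show False using R(2) by (auto simp: acyclic_def)
  qed
  with assms show ?thesis
    by (simp add: acyclic_injections_def partial_injection_image)
qed

lemma inj_on_relation_image:
  assumes "inj_on f S"
  shows "inj_on (\<lambda>R. map_prod f f ` R) (Pow (S \<times> S))"
  by (rule inj_on_image_Pow) (rule map_prod_inj_on[OF assms assms])

text \<open>Renaming the points along a bijection of ground sets is injective on relations, so any
  family of relations stable under renaming has a size that depends only on the size of the
  ground set.\<close>

lemma card_relations_le:
  assumes "finite S" "finite T" "card S = card T"
    and fin: "\<And>S. finite S \<Longrightarrow> finite (F S)"
    and sub: "\<And>S. F S \<subseteq> Pow (S \<times> S)"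
    and img: "\<And>f S R. inj_on f S \<Longrightarrow> R \<in> F S \<Longrightarrow> map_prod f f ` R \<in> F (f ` S)"
  shows "card (F S) \<le> card (F T)"
proof -
  obtain f where f: "bij_betw f S T"
    using finite_same_card_bij[OF assms(1-3)] by blast
  then have inj: "inj_on f S" and T: "f ` S = T" by (auto simp: bij_betw_def)
  show ?thesis
  proof (rule card_inj_on_le)
    show "inj_on (\<lambda>R. map_prod f f ` R) (F S)"
      by (rule inj_on_subset[OF inj_on_relation_image[OF inj] sub])
    show "(\<lambda>R. map_prod f f ` R) ` F S \<subseteq> F T"
      using img[OF inj] T by blast
    show "finite (F T)" by (rule fin[OF assms(2)])
  qed
qed

lemma card_partial_injections_cong:
  fixes S T :: "'a set"
  assumes "finite S" "finite T" "card S = card T"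
  shows "card (partial_injections S) = card (partial_injections T)"
proof (rule antisym)
  have sub: "partial_injections A \<subseteq> Pow (A \<times> A)" for A :: "'a set"
    by (auto simp: partial_injections_def)
  note le = card_relations_le[where F = partial_injections,
      OF _ _ _ finite_partial_injections sub partial_injection_image]
  show "card (partial_injections S) \<le> card (partial_injections T)"
    by (rule le) (use assms in auto)
  show "card (partial_injections T) \<le> card (partial_injections S)"
    by (rule le) (use assms in auto)
qed

lemma card_acyclic_injections_cong:
  fixes S T :: "'a set"
  assumes "finite S" "finite T" "card S = card T"
  shows "card (acyclic_injections S) = card (acyclic_injections T)"
proof (rule antisym)
  have sub: "acyclic_injections A \<subseteq> Pow (A \<times> A)" for A :: "'a set"
    by (auto simp: injections_defs)
  note le = card_relations_le[where F = acyclic_injections,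
      OF _ _ _ finite_acyclic_injections sub acyclic_injection_image]
  show "card (acyclic_injections S) \<le> card (acyclic_injections T)"
    by (rule le) (use assms in auto)
  show "card (acyclic_injections T) \<le> card (acyclic_injections S)"
    by (rule le) (use assms in auto)
qed

section \<open>Deleting a terminal point\<close>

lemma acyclic_injections_isolated:
  assumes "x \<notin> S"
  shows "{R \<in> acyclic_injections (insert x S). x \<notin> Domain R \<and> x \<notin> Range R} =
    acyclic_injections S"
proof (rule set_eqI)
  fix R :: "'a rel"
  have "R \<subseteq> S \<times> S \<longleftrightarrow> R \<subseteq> insert x S \<times> insert x S \<and> x \<notin> Domain R \<and> x \<notin> Range R"
    using assms by blast
  then show "R \<in> {R \<in> acyclic_injections (insert x S). x \<notin> Domain R \<and> x \<notin> Range R} \<longleftrightarrow>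
      R \<in> acyclic_injections S"
    unfolding injections_defs mem_Collect_eq by argo
qed

text \<open>Appending \<open>x\<close> behind a point \<open>p\<close> that has no successor: no cycle can arise because
  nothing leaves \<open>x\<close>.\<close>

lemma bij_betw_append_arrow:
  assumes "x \<notin> S" "p \<in> S"
  shows "bij_betw (insert (p, x)) {R \<in> acyclic_injections S. p \<notin> Domain R}
    {R \<in> acyclic_injections (insert x S). x \<notin> Domain R \<and> (p, x) \<in> R}"
proof (rule bij_betw_byWitness[where f' = "\<lambda>R. R - {(p, x)}"])
  show "\<forall>R\<in>{R \<in> acyclic_injections S. p \<notin> Domain R}. insert (p, x) R - {(p, x)} = R"
    by auto
  show "\<forall>R\<in>{R \<in> acyclic_injections (insert x S). x \<notin> Domain R \<and> (p, x) \<in> R}.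
    insert (p, x) (R - {(p, x)}) = R" by auto
  show "insert (p, x) ` {R \<in> acyclic_injections S. p \<notin> Domain R}
    \<subseteq> {R \<in> acyclic_injections (insert x S). x \<notin> Domain R \<and> (p, x) \<in> R}"
  proof (rule image_subsetI)
    fix R assume "R \<in> {R \<in> acyclic_injections S. p \<notin> Domain R}"
    then have R: "R \<in> acyclic_injections S" "p \<notin> Domain R" by auto
    then have x: "x \<notin> Domain R" "x \<notin> Range R" "x \<noteq> p"
      using assms by (auto simp: injections_defs)
    then have "(x, p) \<notin> R\<^sup>*"
      by (metis DomainI converse_rtranclE)
    then have "acyclic (insert (p, x) R)"
      using R by (simp add: injections_defs acyclic_insert)
    moreover have "insert (p, x) R \<in> partial_injections (insert x S)"
      using R x assms unfolding injections_defs single_valued_def by blast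
    ultimately show "insert (p, x) R
        \<in> {R \<in> acyclic_injections (insert x S). x \<notin> Domain R \<and> (p, x) \<in> R}"
      using x by (auto simp: acyclic_injections_def)
  qed
  show "(\<lambda>R. R - {(p, x)}) ` {R \<in> acyclic_injections (insert x S). x \<notin> Domain R \<and> (p, x) \<in> R}
    \<subseteq> {R \<in> acyclic_injections S. p \<notin> Domain R}"
  proof (rule image_subsetI)
    fix R assume "R \<in> {R \<in> acyclic_injections (insert x S). x \<notin> Domain R \<and> (p, x) \<in> R}"
    then have R: "R \<in> acyclic_injections (insert x S)" "x \<notin> Domain R" "(p, x) \<in> R"
      by auto
    have "acyclic (R - {(p, x)})"
      using R acyclic_subset[of R "R - {(p, x)}"] by (auto simp: injections_defs)
    moreover have "R - {(p, x)} \<in> partial_injections S"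
      using R unfolding injections_defs single_valued_def by blast
    moreover have "p \<notin> Domain (R - {(p, x)})"
      using R unfolding injections_defs single_valued_def by blast
    ultimately show "R - {(p, x)} \<in> {R \<in> acyclic_injections S. p \<notin> Domain R}"
      by (simp add: acyclic_injections_def)
  qed
qed

lemma card_terminal_insert:
  assumes "finite S" "x \<notin> S"
  shows "card {R \<in> acyclic_injections (insert x S). x \<notin> Domain R} =
    card (acyclic_injections S) + (\<Sum>p\<in>S. card {R \<in> acyclic_injections S. p \<notin> Domain R})"
proof -
  let ?N = "acyclic_injections (insert x S)"
  let ?P = "\<lambda>p. {R \<in> ?N. x \<notin> Domain R \<and> (p, x) \<in> R}"
  have "{R \<in> ?N. x \<notin> Domain R} =
      {R \<in> ?N. x \<notin> Domain R \<and> x \<notin> Range R} \<union> (\<Union>p\<in>S. ?P p)"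
    unfolding injections_defs by (auto 0 4)
  then have "{R \<in> ?N. x \<notin> Domain R} = acyclic_injections S \<union> (\<Union>p\<in>S. ?P p)"
    by (simp only: acyclic_injections_isolated[OF assms(2)])
  moreover have "card (acyclic_injections S \<union> (\<Union>p\<in>S. ?P p)) =
      card (acyclic_injections S) + card (\<Union>p\<in>S. ?P p)"
    using assms by (intro card_Un_disjoint) (auto simp: injections_defs)
  moreover have "card (\<Union>p\<in>S. ?P p) = (\<Sum>p\<in>S. card (?P p))"
    using assms by (intro card_UN_disjoint) (auto simp: injections_defs single_valued_def)
  moreover have "card (?P p) = card {R \<in> acyclic_injections S. p \<notin> Domain R}" if "p \<in> S" for p
    using bij_betw_same_card[OF bij_betw_append_arrow[OF assms(2) that]] by simp
  ultimately show ?thesis by simp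
qed

text \<open>Double counting of the pairs of a relation and a point without successor.\<close>

lemma sum_card_terminal:
  assumes "finite S"
  shows "(\<Sum>p\<in>S. card {R \<in> acyclic_injections S. p \<notin> Domain R}) =
    (\<Sum>R\<in>acyclic_injections S. card (S - Domain R))"
proof -
  have "(\<Sum>p\<in>S. \<Sum>R | R \<in> acyclic_injections S \<and> p \<notin> Domain R. 1) =
      (\<Sum>R\<in>acyclic_injections S. \<Sum>p | p \<in> S \<and> p \<notin> Domain R. (1::nat))"
    using assms by (intro sum.swap_restrict) auto
  then show ?thesis by (simp add: set_diff_eq)
qed

section \<open>Splitting off the periodic points\<close>

definition periodic_points :: "'a rel \<Rightarrow> 'a set" where
  "periodic_points R = {z. (z, z) \<in> R\<^sup>+}"

text \<open>On a finite set these relations are the graphs of the permutations.\<close>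

definition full_injections :: "'a set \<Rightarrow> 'a rel set" where
  "full_injections A = {R \<in> partial_injections A. Domain R = A}"

lemma periodic_successor:
  assumes "single_valued R" "z \<in> periodic_points R" "(z, w) \<in> R"
  shows "w \<in> periodic_points R"
proof -
  obtain v where "(z, v) \<in> R" "(v, z) \<in> R\<^sup>*"
    using assms(2) by (auto simp: periodic_points_def dest: tranclD)
  then have "(w, z) \<in> R\<^sup>*" using assms by (metis single_valuedD)
  with assms(3) show ?thesis by (auto simp: periodic_points_def)
qed

lemma periodic_points_converse: "periodic_points (R\<inverse>) = periodic_points R"
  by (simp add: periodic_points_def trancl_converse)

lemma periodic_predecessor:
  assumes "single_valued (R\<inverse>)" "z \<in> periodic_points R" "(w, z) \<in> R"
  shows "w \<in> periodic_points R"
  using periodic_successor[of "R\<inverse>" z w] assms by (simp add: periodic_points_converse)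

lemma periodic_points_Domain: "periodic_points R \<subseteq> Domain R"
  by (auto simp: periodic_points_def dest: tranclD)

lemma trancl_Un_disjoint:
  assumes "P \<subseteq> A \<times> A" "Q \<subseteq> B \<times> B" "A \<inter> B = {}" "(a, b) \<in> (P \<union> Q)\<^sup>+"
  shows "(a, b) \<in> P\<^sup>+ \<or> (a, b) \<in> Q\<^sup>+"
  using assms(4)
proof (induction rule: trancl_induct)
  case (step b c)
  have "P\<^sup>+ \<subseteq> A \<times> A" "Q\<^sup>+ \<subseteq> B \<times> B"
    using assms(1,2) by (simp_all add: trancl_subset_Sigma)
  with step assms show ?case by (blast intro: trancl_into_trancl)
qed auto

text \<open>A full injection has nothing but cycles: on the non-periodic points its arrows would
  form a finite acyclic relation in which every point has a successor.\<close>

lemma periodic_points_full: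
  assumes "finite A" "R \<in> full_injections A"
  shows "periodic_points R = A"
proof (rule ccontr)
  let ?C = "periodic_points R"
  assume "?C \<noteq> A"
  have R: "R \<subseteq> A \<times> A" "single_valued R" "single_valued (R\<inverse>)" "Domain R = A"
    using assms by (auto simp: full_injections_def partial_injections_def)
  have "?C \<subseteq> A" using periodic_points_Domain[of R] R(4) by simp
  with \<open>?C \<noteq> A\<close> have ne: "A - ?C \<noteq> {}" by auto
  let ?Q = "R - ?C \<times> ?C"
  have "acyclic ?Q"
    unfolding acyclic_def
  proof safe
    fix z assume z: "(z, z) \<in> ?Q\<^sup>+"
    then have "z \<in> ?C"
      unfolding periodic_points_def using trancl_mono[OF z, of R] by simp
    moreover obtain w where "(z, w) \<in> ?Q" using z by (auto dest: tranclD)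
    ultimately show False using periodic_successor[OF R(2), of z w] by blast
  qed
  moreover have "finite ?Q" using assms(1) R(1) by (meson finite_Diff finite_SigmaI finite_subset)
  ultimately have "wf (?Q\<inverse>)" by (rule finite_acyclic_wf_converse[rotated])
  \<comment> \<open>A point that ends the acyclic part: its successor would have to be periodic.\<close>
  then obtain z where z: "z \<in> A - ?C" "\<And>y. (z, y) \<in> ?Q \<Longrightarrow> y \<notin> A - ?C"
    using ne unfolding wf_eq_minimal by (metis converse_iff ex_in_conv)
  then obtain y where y: "(z, y) \<in> R" using R(4) by blast
  then have "y \<in> A - ?C" using z(1) periodic_predecessor[OF R(3), of y z] R(1) by blast
  moreover have "(z, y) \<in> ?Q" using y z(1) by blast
  ultimately show False using z(2) by blast
qed

text \<open>The periodic points are closed under successors and predecessors, so no arrow connects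
  them with the rest, and the arrows among the rest are acyclic. Conversely the permuted set can
  be read off from the union as its set of periodic points.\<close>

lemma bij_betw_core_decomposition:
  assumes "finite S"
  shows "bij_betw (\<lambda>(A, P, Q). P \<union> Q)
    (SIGMA A:Pow S. full_injections A \<times> acyclic_injections (S - A)) (partial_injections S)"
proof (rule bij_betw_byWitness[where f' = "\<lambda>R. (periodic_points R,
    R \<inter> periodic_points R \<times> periodic_points R, R - periodic_points R \<times> periodic_points R)"])
  have dec: "periodic_points (P \<union> Q) = A \<and> (P \<union> Q) \<inter> A \<times> A = P \<and> (P \<union> Q) - A \<times> A = Q"
    if "A \<subseteq> S" "P \<in> full_injections A" "Q \<in> acyclic_injections (S - A)" for A P Q
  proof -
    have P: "P \<subseteq> A \<times> A" and Q: "Q \<subseteq> (S - A) \<times> (S - A)" "acyclic Q"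
      using that by (auto simp: full_injections_def injections_defs)
    have "periodic_points P = A"
      using that assms by (intro periodic_points_full) (auto intro: finite_subset)
    moreover have "periodic_points (P \<union> Q) = periodic_points P"
    proof
      show "periodic_points P \<subseteq> periodic_points (P \<union> Q)"
        by (auto simp: periodic_points_def intro: trancl_mono)
      show "periodic_points (P \<union> Q) \<subseteq> periodic_points P"
        using trancl_Un_disjoint[OF P Q(1)] Q(2)
        by (auto simp: periodic_points_def acyclic_def)
    qed
    ultimately show ?thesis using P Q(1) by blast
  qed
  then show "\<forall>a\<in>SIGMA A:Pow S. full_injections A \<times> acyclic_injections (S - A).
     (\<lambda>R. (periodic_points R, R \<inter> periodic_points R \<times> periodic_points R,
       R - periodic_points R \<times> periodic_points R)) ((\<lambda>(A, P, Q). P \<union> Q) a) = a"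
    by auto
  show "\<forall>R\<in>partial_injections S. (\<lambda>(A, P, Q). P \<union> Q) (periodic_points R,
    R \<inter> periodic_points R \<times> periodic_points R, R - periodic_points R \<times> periodic_points R) = R"
    by auto
  show "(\<lambda>(A, P, Q). P \<union> Q) ` (SIGMA A:Pow S. full_injections A \<times> acyclic_injections (S - A))
    \<subseteq> partial_injections S"
    unfolding full_injections_def injections_defs single_valued_def by (clarsimp; blast)
  show "(\<lambda>R. (periodic_points R, R \<inter> periodic_points R \<times> periodic_points R,
      R - periodic_points R \<times> periodic_points R)) ` partial_injections S
    \<subseteq> (SIGMA A:Pow S. full_injections A \<times> acyclic_injections (S - A))"
  proof safe
    fix R z assume R: "R \<in> partial_injections S"
    let ?C = "periodic_points R"
    have sv: "R \<subseteq> S \<times> S" "single_valued R" "single_valued (R\<inverse>)"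
      using R by (auto simp: partial_injections_def)
    note succ = periodic_successor[OF sv(2)] and pred = periodic_predecessor[OF sv(3)]
    show "z \<in> S" if "z \<in> ?C" using that periodic_points_Domain[of R] sv(1) by blast
    have "Domain (R \<inter> ?C \<times> ?C) = ?C"
      using periodic_points_Domain[of R] succ by blast
    then show "R \<inter> ?C \<times> ?C \<in> full_injections ?C"
      using sv(2,3) unfolding full_injections_def partial_injections_def single_valued_def by blast
    have "acyclic (R - ?C \<times> ?C)"
      unfolding acyclic_def
    proof safe
      fix z assume z: "(z, z) \<in> (R - ?C \<times> ?C)\<^sup>+"
      then have "z \<in> ?C"
        unfolding periodic_points_def using trancl_mono[OF z, of R] by simp
      moreover obtain w where "(z, w) \<in> R - ?C \<times> ?C" using z by (auto dest: tranclD)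
      ultimately show False using succ by blast
    qed
    moreover have "R - ?C \<times> ?C \<subseteq> (S - ?C) \<times> (S - ?C)"
      using sv(1) succ pred by blast
    ultimately show "R - ?C \<times> ?C \<in> acyclic_injections (S - ?C)"
      using sv(2,3) unfolding injections_defs single_valued_def by blast
  qed
qed

lemma card_full_injections:
  assumes "finite A"
  shows "card (full_injections A) = fact (card A)"
proof -
  have "bij_betw (\<lambda>p. {(z, p z) | z. z \<in> A}) {p. p permutes A} (full_injections A)"
    unfolding bij_betw_def
  proof
    show "inj_on (\<lambda>p. {(z, p z) | z. z \<in> A}) {p. p permutes A}"
    proof (rule inj_onI, rule ext)
      fix p q z assume *: "p \<in> {p. p permutes A}" "q \<in> {p. p permutes A}"
        "{(z, p z) | z. z \<in> A} = {(z, q z) | z. z \<in> A}"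
      show "p z = q z"
      proof (cases "z \<in> A")
        case True
        then have "(z, p z) \<in> {(z, q z) | z. z \<in> A}" using *(3) by blast
        then show ?thesis by auto
      qed (use * in \<open>auto simp: permutes_not_in\<close>)
    qed
    show "(\<lambda>p. {(z, p z) | z. z \<in> A}) ` {p. p permutes A} = full_injections A"
    proof
      show "(\<lambda>p. {(z, p z) | z. z \<in> A}) ` {p. p permutes A} \<subseteq> full_injections A"
      proof (rule image_subsetI)
        fix p assume "p \<in> {p. p permutes A}"
        then have p: "\<And>z. p z \<in> A \<longleftrightarrow> z \<in> A" "inj p"
          by (simp_all add: permutes_in_image permutes_inj)
        show "{(z, p z) | z. z \<in> A} \<in> full_injections A"
          using p unfolding full_injections_def partial_injections_def single_valued_def inj_on_def
          by auto
      qed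
      show "full_injections A \<subseteq> (\<lambda>p. {(z, p z) | z. z \<in> A}) ` {p. p permutes A}"
      proof
        fix R assume "R \<in> full_injections A"
        then have R: "R \<subseteq> A \<times> A" "single_valued R" "single_valued (R\<inverse>)" "Domain R = A"
          by (auto simp: full_injections_def partial_injections_def)
        define p where "p z = (if z \<in> A then THE w. (z, w) \<in> R else z)" for z
        have p: "(z, w) \<in> R \<longleftrightarrow> w = p z" if z: "z \<in> A" for z w
        proof -
          obtain v where v: "(z, v) \<in> R" using R(4) z by blast
          then have "(THE w. (z, w) \<in> R) = v"
            using R(2) by (auto simp: single_valued_def)
          then show ?thesis using z v R(2) by (auto simp: p_def single_valued_def)
        qed
        have "p ` A \<subseteq> A" using p R(1) by blast
        moreover have "inj_on p A"
          using p R(3) unfolding inj_on_def single_valued_def by blast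
        ultimately have "bij_betw p A A"
          using assms by (simp add: bij_betw_def endo_inj_surj)
        then have "p permutes A" by (rule bij_imp_permutes) (simp add: p_def)
        moreover have "R = {(z, p z) | z. z \<in> A}" using p R(1) by auto
        ultimately show "R \<in> (\<lambda>p. {(z, p z) | z. z \<in> A}) ` {p. p permutes A}" by blast
      qed
    qed
  qed
  from bij_betw_same_card[OF this] show ?thesis
    using card_permutations[OF refl assms] by simp
qed

lemma card_partial_injections:
  assumes "finite S"
  shows "card (partial_injections S) =
    (\<Sum>A\<in>Pow S. fact (card A) * card (acyclic_injections (S - A)))"
proof -
  have fin: "finite A" if "A \<in> Pow S" for A
    using that assms finite_subset[of A S] by simp
  have "card (partial_injections S) =
      card (SIGMA A:Pow S. full_injections A \<times> acyclic_injections (S - A))"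
    using bij_betw_same_card[OF bij_betw_core_decomposition[OF assms]] by simp
  also have "\<dots> = (\<Sum>A\<in>Pow S. card (full_injections A \<times> acyclic_injections (S - A)))"
    using assms fin by (intro card_SigmaI) (auto simp: full_injections_def)
  also have "\<dots> = (\<Sum>A\<in>Pow S. fact (card A) * card (acyclic_injections (S - A)))"
    using fin by (intro sum.cong) (auto simp: card_cartesian_product card_full_injections)
  finally show ?thesis .
qed

text \<open>Unrolls the recursion of \<open>card_terminal_insert\<close>. For the predecessor \<open>p\<close> of \<open>x\<close> the
  induction hypothesis gives a sum over the \<open>B \<subseteq> S - {p}\<close>, rewritten as a sum over \<open>A = B \<union> {p}\<close>.
  Each nonempty \<open>A \<subseteq> S\<close> then occurs once for each of its elements, which turns \<open>(|A| - 1)!\<close> into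
  \<open>|A|!\<close>; the empty set accounts for the case that \<open>x\<close> has no predecessor.\<close>

lemma card_terminal_eq_sum:
  assumes "finite S" "x \<notin> S"
  shows "card {R \<in> acyclic_injections (insert x S). x \<notin> Domain R} =
    (\<Sum>A\<in>Pow S. fact (card A) * card (acyclic_injections (S - A)))"
  using assms
proof (induction "card S" arbitrary: S x rule: less_induct)
  case less
  let ?t = "\<lambda>A. card (acyclic_injections (S - A))"
  have fin: "finite A" if "A \<in> Pow S" for A
    using that less.prems(1) finite_subset[of A S] by simp
  have step: "card {R \<in> acyclic_injections S. p \<notin> Domain R} =
      (\<Sum>A | A \<in> Pow S \<and> p \<in> A. fact (card A - 1) * ?t A)" if p: "p \<in> S" for p
  proof -
    have "insert p (S - {p}) = S" using p by auto
    then have "card {R \<in> acyclic_injections S. p \<notin> Domain R} =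
        (\<Sum>B\<in>Pow (S - {p}). fact (card B) * card (acyclic_injections (S - {p} - B)))"
      using less.hyps[OF card_Diff1_less[OF less.prems(1) p], of p] less.prems(1) by simp
    also have "\<dots> = (\<Sum>A | A \<in> Pow S \<and> p \<in> A. fact (card A - 1) * ?t A)"
    proof (rule sum.reindex_bij_witness[where i = "\<lambda>A. A - {p}" and j = "insert p"])
      fix B assume B: "B \<in> Pow (S - {p})"
      then have "finite B" "p \<notin> B" using less.prems(1) finite_subset by auto
      moreover have "S - insert p B = S - {p} - B" by auto
      ultimately show "fact (card (insert p B) - 1) * ?t (insert p B) =
        fact (card B) * card (acyclic_injections (S - {p} - B))" by simp
    qed (use p in auto)
    finally show ?thesis .
  qed
  have "(\<Sum>p\<in>S. card {R \<in> acyclic_injections S. p \<notin> Domain R}) =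
      (\<Sum>p\<in>S. \<Sum>A | A \<in> Pow S \<and> p \<in> A. fact (card A - 1) * ?t A)"
    using step by simp
  also have "\<dots> = (\<Sum>A\<in>Pow S. \<Sum>p | p \<in> S \<and> p \<in> A. fact (card A - 1) * ?t A)"
    using less.prems by (intro sum.swap_restrict) auto
  also have "\<dots> = (\<Sum>A\<in>Pow S. card A * (fact (card A - 1) * ?t A))"
  proof (rule sum.cong)
    fix A assume "A \<in> Pow S"
    then have "{p. p \<in> S \<and> p \<in> A} = A" by auto
    then show "(\<Sum>p | p \<in> S \<and> p \<in> A. fact (card A - 1) * ?t A) =
      card A * (fact (card A - 1) * ?t A)" by simp
  qed simp
  also have "\<dots> = (\<Sum>A\<in>Pow S - {{}}. card A * (fact (card A - 1) * ?t A))"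
    using less.prems by (intro sum.mono_neutral_right) auto
  also have "\<dots> = (\<Sum>A\<in>Pow S - {{}}. fact (card A) * ?t A)"
    by (rule sum.cong) (use fin in \<open>auto simp: fact_reduce card_gt_0_iff\<close>)
  finally have "(\<Sum>p\<in>S. card {R \<in> acyclic_injections S. p \<notin> Domain R}) =
    (\<Sum>A\<in>Pow S - {{}}. fact (card A) * ?t A)" .
  moreover have "(\<Sum>A\<in>Pow S. fact (card A) * ?t A) =
      ?t {} + (\<Sum>A\<in>Pow S - {{}}. fact (card A) * ?t A)"
    using less.prems by (subst sum.remove[of _ "{}"]) auto
  ultimately show ?case
    using card_terminal_insert[OF less.prems] by simp
qed

lemma card_terminal:
  assumes "finite S" "x \<in> S"
  shows "card {R \<in> acyclic_injections S. x \<notin> Domain R} = card (partial_injections (S - {x}))"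
  using card_terminal_eq_sum[of "S - {x}" x] card_partial_injections[of "S - {x}"] assms
  by (simp add: insert_absorb)

section \<open>Contracting an arrow\<close>

text \<open>Given an arrow \<open>x \<rightarrow> y\<close>, the two points are merged into one that keeps the name \<open>y\<close>: it
  inherits the predecessor of \<open>x\<close> and the successor of \<open>y\<close>. The inverse \<open>expand\<close> inserts \<open>x\<close> in front
  of \<open>y\<close>.\<close>

definition contract :: "'a \<Rightarrow> 'a \<Rightarrow> 'a rel \<Rightarrow> 'a rel" where
  "contract x y R = {(a, b). a \<noteq> x \<and> b \<noteq> x \<and> (a, b) \<in> R \<or> b = y \<and> (a, x) \<in> R}"

definition expand :: "'a \<Rightarrow> 'a \<Rightarrow> 'a rel \<Rightarrow> 'a rel" where
  "expand x y R = insert (x, y) {(a, b). b \<noteq> y \<and> (a, b) \<in> R \<or> b = x \<and> (a, y) \<in> R}"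

lemma contract_trancl_subset:
  assumes "(x, y) \<in> R"
  shows "(contract x y R)\<^sup>+ \<subseteq> R\<^sup>+"
proof -
  have "contract x y R \<subseteq> R\<^sup>+"
    using assms by (auto simp: contract_def intro: trancl_into_trancl)
  then show ?thesis by (metis trancl_mono_subset trancl_id trans_trancl)
qed

lemma contract_acyclic_injections:
  assumes "x \<notin> S" "y \<in> S" "R \<in> acyclic_injections (insert x S)" "(x, y) \<in> R"
  shows "contract x y R \<in> acyclic_injections S"
proof -
  have R: "R \<subseteq> insert x S \<times> insert x S" "single_valued R" "single_valued (R\<inverse>)" "acyclic R"
    using assms by (auto simp: injections_defs)
  have "(x, x) \<notin> R" using R(4) by (auto simp: acyclic_def)
  then have "contract x y R \<subseteq> S \<times> S"
    using R(1) assms by (auto simp: contract_def)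
  moreover have "acyclic (contract x y R)"
    using R(4) contract_trancl_subset[OF assms(4)] by (auto simp: acyclic_def)
  moreover have "single_valued (contract x y R)"
    using R(2) unfolding contract_def single_valued_def by blast
  moreover have "single_valued ((contract x y R)\<inverse>)"
    using R(3) assms(4) unfolding contract_def single_valued_def by blast
  ultimately show ?thesis by (simp add: injections_defs)
qed

text \<open>Merging \<open>x\<close> into \<open>y\<close> maps every walk of the expanded relation that avoids the arrow
  \<open>x \<rightarrow> y\<close> to a walk of the original one of the same length. A cycle without that arrow would
  give a cycle there, and a cycle with it would give a closed walk at \<open>y\<close>.\<close>

lemma expand_acyclic_injections:
  assumes "x \<notin> S" "y \<in> S" "R \<in> acyclic_injections S"
  shows "expand x y R \<in> acyclic_injections (insert x S)"
proof -
  have R: "R \<subseteq> S \<times> S" "single_valued R" "single_valued (R\<inverse>)" "acyclic R"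
    using assms by (auto simp: injections_defs)
  \<comment> \<open>\<open>Q\<close> is the expanded relation without its new arrow.\<close>
  define Q where "Q = {(a, b). b \<noteq> y \<and> (a, b) \<in> R \<or> b = x \<and> (a, y) \<in> R}"
  have xy: "x \<noteq> y" and xD: "x \<notin> Domain Q" using assms R(1) by (auto simp: Q_def)
  \<comment> \<open>Intermediate points of a \<open>Q\<close>-walk differ from \<open>x\<close>, which has no successor in \<open>Q\<close>.\<close>
  have Q_R: "(a, if b = x then y else b) \<in> R\<^sup>+" if "(a, b) \<in> Q\<^sup>+" for a b
    using that
  proof (induction rule: trancl_induct)
    case (base b)
    then show ?case using R(1) assms(1) by (auto simp: Q_def)
  next
    case (step b c)
    then have "b \<noteq> x" using xD by auto
    moreover have "(b, if c = x then y else c) \<in> R"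
      using step R(1) assms(1) by (auto simp: Q_def)
    ultimately show ?case using step.IH by (auto intro: trancl_into_trancl)
  qed
  have "acyclic Q"
    unfolding acyclic_def
  proof safe
    fix z assume z: "(z, z) \<in> Q\<^sup>+"
    then have "z \<noteq> x" using xD by (metis DomainI tranclD)
    then show False using Q_R[OF z] R(4) by (auto simp: acyclic_def)
  qed
  moreover have "(y, x) \<notin> Q\<^sup>*"
    using Q_R[of y x] xy R(4) by (auto simp: acyclic_def rtrancl_eq_or_trancl)
  moreover have Q: "expand x y R = insert (x, y) Q" by (simp add: expand_def Q_def)
  ultimately have "acyclic (expand x y R)" by simp
  moreover have "expand x y R \<subseteq> insert x S \<times> insert x S"
    using R(1) assms by (auto simp: expand_def)
  moreover have "single_valued (expand x y R)"
    using R(1,2) assms(1) unfolding expand_def single_valued_def by blast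
  moreover have "single_valued ((expand x y R)\<inverse>)"
    using R(1,3) assms(1) unfolding expand_def single_valued_def by blast
  ultimately show ?thesis by (simp add: injections_defs)
qed

lemma bij_betw_contract:
  assumes "x \<notin> S" "y \<in> S"
  shows "bij_betw (contract x y) {R \<in> acyclic_injections (insert x S). (x, y) \<in> R}
    (acyclic_injections S)"
proof (rule bij_betw_byWitness[where f' = "expand x y"])
  have xy: "x \<noteq> y" using assms by auto
  show "\<forall>R\<in>{R \<in> acyclic_injections (insert x S). (x, y) \<in> R}. expand x y (contract x y R) = R"
  proof safe
    fix R a b assume "R \<in> acyclic_injections (insert x S)" and arr: "(x, y) \<in> R"
    then have R: "single_valued R" "single_valued (R\<inverse>)" "acyclic R"
      by (auto simp: injections_defs)
    have "(x, x) \<notin> R" using R(3) by (auto simp: acyclic_def)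
    moreover have "b = y" if "(x, b) \<in> R" for b using that arr R(1) by (metis single_valuedD)
    moreover have "a = x" if "(a, y) \<in> R" for a
      using that arr R(2) by (metis converse_iff single_valuedD)
    ultimately show "(a, b) \<in> expand x y (contract x y R) \<Longrightarrow> (a, b) \<in> R"
      and "(a, b) \<in> R \<Longrightarrow> (a, b) \<in> expand x y (contract x y R)"
      using arr xy unfolding expand_def contract_def by blast+
  qed
  show "\<forall>R\<in>acyclic_injections S. contract x y (expand x y R) = R"
  proof safe
    fix R a b assume "R \<in> acyclic_injections S"
    then have "x \<notin> Domain R" "x \<notin> Range R"
      using assms by (auto simp: injections_defs)
    then show "(a, b) \<in> contract x y (expand x y R) \<Longrightarrow> (a, b) \<in> R"
      and "(a, b) \<in> R \<Longrightarrow> (a, b) \<in> contract x y (expand x y R)"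
      using xy unfolding expand_def contract_def by blast+
  qed
  show "contract x y ` {R \<in> acyclic_injections (insert x S). (x, y) \<in> R} \<subseteq> acyclic_injections S"
    using contract_acyclic_injections[OF assms] by auto
  show "expand x y ` acyclic_injections S
    \<subseteq> {R \<in> acyclic_injections (insert x S). (x, y) \<in> R}"
    using expand_acyclic_injections[OF assms] by (auto simp: expand_def)
qed

lemma reachable_contract:
  assumes "single_valued R" "(x, y) \<in> R"
  shows "R\<^sup>* `` {x} = insert x ((contract x y R)\<^sup>* `` {y})"
proof
  let ?Q = "contract x y R"
  have "z = x \<or> (y, z) \<in> ?Q\<^sup>*" if "(x, z) \<in> R\<^sup>*" for z
    using that
  proof (induction rule: rtrancl_induct)
    case (step z w)
    show ?case
    proof (cases "z = x")
      case True
      then have "w = y" using step(2) assms by (metis single_valuedD)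
      then show ?thesis by simp
    next
      case False
      then have "w = x \<or> (z, w) \<in> ?Q" using step(2) by (auto simp: contract_def)
      then show ?thesis using step.IH False by (auto intro: rtrancl_into_rtrancl)
    qed
  qed simp
  then show "R\<^sup>* `` {x} \<subseteq> insert x (?Q\<^sup>* `` {y})" by auto
  have "?Q\<^sup>* \<subseteq> R\<^sup>*"
    using contract_trancl_subset[OF assms(2)] by (auto simp: rtrancl_eq_or_trancl)
  then show "insert x (?Q\<^sup>* `` {y}) \<subseteq> R\<^sup>* `` {x}"
    using assms(2) by (auto intro: converse_rtrancl_into_rtrancl)
qed

lemma card_reachable_contract:
  assumes "finite S" "x \<notin> S" "y \<in> S" "R \<in> acyclic_injections (insert x S)" "(x, y) \<in> R"
  shows "card (R\<^sup>* `` {x}) = Suc (card ((contract x y R)\<^sup>* `` {y}))"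
proof -
  let ?Q = "contract x y R"
  have "?Q \<subseteq> S \<times> S"
    using contract_acyclic_injections[OF assms(2-5)] by (auto simp: injections_defs)
  then have "?Q\<^sup>* `` {y} \<subseteq> S"
    using assms(3) trancl_subset_Sigma[of ?Q S] by (auto simp: rtrancl_eq_or_trancl)
  then have "finite (?Q\<^sup>* `` {y})" "x \<notin> ?Q\<^sup>* `` {y}" using assms finite_subset by auto
  moreover have "single_valued R" using assms by (auto simp: injections_defs)
  ultimately show ?thesis using reachable_contract[of R x y] assms(5) by simp
qed

text \<open>Sorts the relations by the successor of \<open>x\<close> and contracts the arrow to it.\<close>

lemma card_reachable_recursion:
  assumes "finite S" "x \<notin> S"
  shows "card {R \<in> acyclic_injections (insert x S). card (R\<^sup>* `` {x}) = Suc (Suc k)} =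
    (\<Sum>y\<in>S. card {R \<in> acyclic_injections S. card (R\<^sup>* `` {y}) = Suc k})"
proof -
  let ?N = "acyclic_injections (insert x S)"
  let ?P = "\<lambda>y. {R \<in> ?N. (x, y) \<in> R \<and> card (R\<^sup>* `` {x}) = Suc (Suc k)}"
  have "\<exists>y\<in>S. (x, y) \<in> R" if "R \<in> ?N" "card (R\<^sup>* `` {x}) = Suc (Suc k)" for R
  proof -
    have "R\<^sup>* `` {x} \<noteq> {x}" using that(2) by auto
    then obtain z where "(x, z) \<in> R\<^sup>*" "z \<noteq> x" by auto
    then obtain y where "(x, y) \<in> R" by (metis converse_rtranclE)
    moreover from this have "y \<noteq> x" using that(1) by (auto simp: injections_defs acyclic_def)
    ultimately show ?thesis using that(1) by (auto simp: injections_defs)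
  qed
  then have "{R \<in> ?N. card (R\<^sup>* `` {x}) = Suc (Suc k)} = (\<Union>y\<in>S. ?P y)" by blast
  moreover have "card (\<Union>y\<in>S. ?P y) = (\<Sum>y\<in>S. card (?P y))"
    using assms by (intro card_UN_disjoint) (auto simp: injections_defs single_valued_def)
  moreover have "card (?P y) = card {R \<in> acyclic_injections S. card (R\<^sup>* `` {y}) = Suc k}"
    if y: "y \<in> S" for y
  proof -
    have bij: "bij_betw (contract x y)
        {R \<in> {R \<in> ?N. (x, y) \<in> R}. card (R\<^sup>* `` {x}) = Suc (Suc k)}
        {R \<in> acyclic_injections S. card (R\<^sup>* `` {y}) = Suc k}"
      by (rule bij_betw_Collect[OF bij_betw_contract[OF assms(2) y]])
        (use card_reachable_contract[OF assms y] in auto)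
    have "{R \<in> {R \<in> ?N. (x, y) \<in> R}. card (R\<^sup>* `` {x}) = Suc (Suc k)} = ?P y" by auto
    with bij_betw_same_card[OF bij] show ?thesis by simp
  qed
  ultimately show ?thesis by simp
qed

lemma dec_factorial_Suc_Suc: "dec_factorial (Suc x) (Suc k) = Suc x * dec_factorial x k"
  unfolding dec_factorial_def by (subst prod.lessThan_Suc_shift) simp

lemma card_reachable_eq_1_iff:
  assumes "acyclic R"
  shows "card (R\<^sup>* `` {x}) = Suc 0 \<longleftrightarrow> x \<notin> Domain R"
proof
  assume "card (R\<^sup>* `` {x}) = Suc 0"
  then obtain a where "R\<^sup>* `` {x} = {a}" by (auto simp: card_1_singleton_iff)
  moreover have "x \<in> R\<^sup>* `` {x}" by simp
  ultimately have *: "y = x" if "(x, y) \<in> R\<^sup>*" for y using that by auto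
  show "x \<notin> Domain R"
  proof
    assume "x \<in> Domain R"
    then obtain y where "(x, y) \<in> R" by auto
    with *[of y] have "(x, x) \<in> R" by auto
    with assms show False by (auto simp: acyclic_def)
  qed
next
  assume "x \<notin> Domain R"
  then have "R\<^sup>* `` {x} = {x}" by (auto elim: converse_rtranclE)
  then show "card (R\<^sup>* `` {x}) = Suc 0" by simp
qed

text \<open>A path of \<open>k + 1\<close> points from \<open>x\<close> is shortened by \<open>k\<close> contractions; \<open>T\<close> stands for
  any set of the size that remains when the shortened start is deleted as well.\<close>

lemma card_reachable:
  fixes S T :: "'a set"
  assumes "finite S" "x \<in> S" "finite T" "card S = Suc (card T + k)"
  shows "card {R \<in> acyclic_injections S. card (R\<^sup>* `` {x}) = Suc k} =
    dec_factorial (card S - 1) k * card (partial_injections T)"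
  using assms
proof (induction k arbitrary: S x)
  case 0
  have "{R \<in> acyclic_injections S. card (R\<^sup>* `` {x}) = Suc 0} =
      {R \<in> acyclic_injections S. x \<notin> Domain R}"
    by (rule Collect_cong) (auto simp: acyclic_injections_def card_reachable_eq_1_iff)
  moreover have "card (partial_injections (S - {x})) = card (partial_injections T)"
    using "0.prems" by (intro card_partial_injections_cong) auto
  ultimately show ?case
    using card_terminal[OF "0.prems"(1,2)] by (simp add: dec_factorial_def)
next
  case (Suc k)
  define S' where "S' = S - {x}"
  have S': "finite S'" "x \<notin> S'" "S = insert x S'" "card S' = Suc (card T + k)"
    using Suc.prems by (auto simp: S'_def)
  have "card {R \<in> acyclic_injections S. card (R\<^sup>* `` {x}) = Suc (Suc k)} =
      (\<Sum>y\<in>S'. card {R \<in> acyclic_injections S'. card (R\<^sup>* `` {y}) = Suc k})"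
    using card_reachable_recursion[OF S'(1,2)] S'(3) by simp
  also have "\<dots> = (\<Sum>y\<in>S'. dec_factorial (card S' - 1) k * card (partial_injections T))"
    using Suc.IH[OF S'(1) _ Suc.prems(3) S'(4)] by simp
  also have "\<dots> = card S' * dec_factorial (card S' - 1) k * card (partial_injections T)"
    by simp
  also have "card S' * dec_factorial (card S' - 1) k = dec_factorial (card S - 1) (Suc k)"
    using S' by (simp add: dec_factorial_Suc_Suc)
  finally show ?case .
qed

section \<open>Partial maps and their arrows\<close>

lemma arrows_iff [simp]: "(x, y) \<in> arrows \<alpha> \<longleftrightarrow> \<alpha> x = Some y"
  by (simp add: arrows_def)

lemma Domain_arrows [simp]: "Domain (arrows \<alpha>) = dom \<alpha>"
  by (auto simp: arrows_def)

lemma Range_arrows [simp]: "Range (arrows \<alpha>) = ran \<alpha>"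
  by (auto simp: arrows_def ran_def)

lemma single_valued_arrows: "single_valued (arrows \<alpha>)"
  by (auto simp: single_valued_def)

lemma single_valued_arrows_converse: "single_valued ((arrows \<alpha>)\<inverse>) \<longleftrightarrow> inj_on \<alpha> (dom \<alpha>)"
  by (auto simp: single_valued_def inj_on_def dom_def)

lemma arrows_subset_Times: "arrows \<alpha> \<subseteq> A \<times> A \<longleftrightarrow> dom \<alpha> \<subseteq> A \<and> ran \<alpha> \<subseteq> A"
proof -
  have "R \<subseteq> A \<times> A \<longleftrightarrow> Domain R \<subseteq> A \<and> Range R \<subseteq> A" for R :: "'a rel" by auto
  from this[of "arrows \<alpha>"] show ?thesis by simp
qed

lemma arrows_in_partial_injections:
  "arrows \<alpha> \<in> partial_injections {1..m} \<longleftrightarrow> \<alpha> \<in> sym_inv_semigroup m"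
  unfolding partial_injections_def sym_inv_semigroup_def mem_Collect_eq arrows_subset_Times
    single_valued_arrows_converse using single_valued_arrows by auto

lemma inj_arrows: "inj arrows"
proof (rule injI, rule ext)
  fix \<alpha> \<beta> :: "'a \<rightharpoonup> 'a" and x assume "arrows \<alpha> = arrows \<beta>"
  then have "\<alpha> x = Some y \<longleftrightarrow> \<beta> x = Some y" for y by (metis arrows_iff)
  then show "\<alpha> x = \<beta> x" by (metis option.exhaust)
qed

lemma single_valued_imp_arrows:
  assumes "single_valued R"
  shows "\<exists>\<alpha>. R = arrows \<alpha>"
proof
  have "(THE y. (x, y) \<in> R) = y" if "(x, y) \<in> R" for x y
    using that assms by (auto simp: single_valued_def)
  then have "(if x \<in> Domain R then Some (THE y. (x, y) \<in> R) else None) = Some y \<longleftrightarrow> (x, y) \<in> R"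
    for x y by (metis Domain.cases DomainI option.distinct(1) option.inject)
  then show "R = arrows (\<lambda>x. if x \<in> Domain R then Some (THE y. (x, y) \<in> R) else None)"
    by (simp add: arrows_def)
qed

lemma bij_betw_arrows:
  "bij_betw arrows (sym_inv_semigroup m) (partial_injections {1..m})"
  unfolding bij_betw_def
proof
  show "inj_on arrows (sym_inv_semigroup m)" using inj_arrows by (rule inj_on_subset) simp
  show "arrows ` sym_inv_semigroup m = partial_injections {1..m}"
  proof
    show "arrows ` sym_inv_semigroup m \<subseteq> partial_injections {1..m}"
      using arrows_in_partial_injections by auto
    show "partial_injections {1..m} \<subseteq> arrows ` sym_inv_semigroup m"
    proof
      fix R :: "nat rel" assume R: "R \<in> partial_injections {1..m}"
      then obtain \<alpha> where "R = arrows \<alpha>"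
        using single_valued_imp_arrows[of R] by (auto simp: partial_injections_def)
      with R show "R \<in> arrows ` sym_inv_semigroup m"
        using arrows_in_partial_injections[of \<alpha> m] by simp
    qed
  qed
qed

lemma arrows_pmap_power: "arrows (pmap_power \<alpha> r) = arrows \<alpha> ^^ r"
proof (induction r)
  case 0
  then show ?case by (auto simp: pmap_power_def)
next
  case (Suc r)
  have "arrows (pmap_power \<alpha> (Suc r)) = arrows (pmap_power \<alpha> r) O arrows \<alpha>"
    by (auto simp: pmap_power_def map_comp_def relcomp_unfold split: option.splits)
  with Suc show ?case by simp
qed

lemma periodic_relpow:
  assumes "single_valued R" "z \<in> periodic_points R"
  shows "\<exists>w. (z, w) \<in> R ^^ k"
  using assms(2)
proof (induction k arbitrary: z)
  case (Suc k)
  then obtain v where v: "(z, v) \<in> R" using periodic_points_Domain[of R] by blast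
  then obtain w where "(v, w) \<in> R ^^ k"
    using Suc.IH periodic_successor[OF assms(1) Suc.prems v] by blast
  then show ?case using v by (blast intro: relpow_Suc_I2)
qed auto

text \<open>Each step along an acyclic relation strictly shrinks the set of points still ahead, which
  bounds the length of all walks.\<close>

lemma acyclic_relpow_bound:
  assumes "acyclic R" "R \<subseteq> S \<times> S" "finite S" "(x, y) \<in> R ^^ r"
  shows "r + card (R\<^sup>+ `` {y}) \<le> card (R\<^sup>+ `` {x})"
  using assms(4)
proof (induction r arbitrary: y)
  case (Suc r)
  then obtain z where z: "(x, z) \<in> R ^^ r" "(z, y) \<in> R" by auto
  have "R\<^sup>+ `` {z} \<subseteq> S" using trancl_subset_Sigma[OF assms(2)] by blast
  moreover have "R\<^sup>+ `` {y} \<subset> R\<^sup>+ `` {z}"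
    using z(2) assms(1) by (auto simp: acyclic_def intro: trancl_into_trancl2)
  ultimately have "card (R\<^sup>+ `` {y}) < card (R\<^sup>+ `` {z})"
    using assms(3) by (intro psubset_card_mono) (auto intro: finite_subset)
  with Suc.IH[OF z(1)] show ?case by simp
qed simp

text \<open>A periodic point survives in every power, and conversely walks of an acyclic relation on
  \<open>m\<close> points have at most \<open>m\<close> steps, so that the power \<open>m + 1\<close> is empty.\<close>

lemma nilpotent_iff_acyclic:
  assumes "\<alpha> \<in> sym_inv_semigroup m"
  shows "(\<exists>r>0. pmap_power \<alpha> r = Map.empty) \<longleftrightarrow> acyclic (arrows \<alpha>)"
proof -
  let ?R = "arrows \<alpha>"
  have empty: "pmap_power \<alpha> r = Map.empty \<longleftrightarrow> ?R ^^ r = {}" for r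
    using arrows_pmap_power[of \<alpha> r] by (metis Domain_arrows Domain_empty_iff dom_eq_empty_conv)
  show ?thesis
  proof
    assume "\<exists>r>0. pmap_power \<alpha> r = Map.empty"
    then obtain r where "?R ^^ r = {}" using empty by auto
    then have "periodic_points ?R = {}"
      using periodic_relpow[OF single_valued_arrows, of _ \<alpha> r] by auto
    then show "acyclic ?R" by (auto simp: periodic_points_def acyclic_def)
  next
    assume acyc: "acyclic ?R"
    have R: "?R \<subseteq> {1..m} \<times> {1..m}"
      using assms arrows_in_partial_injections[of \<alpha> m] by (simp add: partial_injections_def)
    have "(x, y) \<notin> ?R ^^ Suc m" for x y
    proof
      assume "(x, y) \<in> ?R ^^ Suc m"
      then have "Suc m + card (?R\<^sup>+ `` {y}) \<le> card (?R\<^sup>+ `` {x})"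
        by (rule acyclic_relpow_bound[OF acyc R finite_atLeastAtMost])
      moreover have "card (?R\<^sup>+ `` {x}) \<le> card {1..m}"
        using trancl_subset_Sigma[OF R] by (intro card_mono) auto
      ultimately show False by simp
    qed
    then have "?R ^^ Suc m = {}" by (auto simp del: relpow.simps)
    then show "\<exists>r>0. pmap_power \<alpha> r = Map.empty" using empty by blast
  qed
qed

lemma bij_betw_arrows_nilpotents:
  "bij_betw arrows (nilpotents m) (acyclic_injections {1..m})"
  unfolding nilpotents_def acyclic_injections_def
  by (rule bij_betw_Collect[OF bij_betw_arrows]) (simp add: nilpotent_iff_acyclic)

lemma card_nilpotents_Collect:
  assumes "\<And>\<alpha>. \<alpha> \<in> nilpotents m \<Longrightarrow> Q (arrows \<alpha>) \<longleftrightarrow> P \<alpha>"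
  shows "card {\<alpha> \<in> nilpotents m. P \<alpha>} = card {R \<in> acyclic_injections {1..m}. Q R}"
  by (rule bij_betw_same_card[OF bij_betw_Collect[OF bij_betw_arrows_nilpotents]])
    (rule assms)

lemma orbit_eq_reachable:
  "orbit \<alpha> x = (if x \<in> dom \<alpha> then (arrows \<alpha>)\<^sup>* `` {x} else {})"
proof -
  have "pmap_power \<alpha> i x = Some y \<longleftrightarrow> (x, y) \<in> arrows \<alpha> ^^ i" for i y
    using arrows_pmap_power[of \<alpha> i] by (metis arrows_iff)
  then show ?thesis by (auto simp: orbit_def rtrancl_power)
qed

section \<open>Chains of a nilpotent map\<close>

lemma chain_nth_reachable:
  assumes "\<And>i. Suc i < length as \<Longrightarrow> (as ! i, as ! Suc i) \<in> R" "i \<le> j" "j < length as"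
  shows "(as ! i, as ! j) \<in> R\<^sup>*"
  using assms(2,3)
proof (induction j rule: dec_induct)
  case (step j)
  then show ?case using assms(1)[of j] by (auto intro: rtrancl_into_rtrancl)
qed simp

text \<open>Paths that cannot be prolonged at their first point. They are followed backwards from the
  last point, where each step is forced.\<close>

definition source_paths :: "'a rel \<Rightarrow> 'a list set" where
  "source_paths R = {as. as \<noteq> [] \<and> (\<forall>i. Suc i < length as \<longrightarrow> (as ! i, as ! Suc i) \<in> R) \<and>
    hd as \<notin> Range R}"

lemma source_paths_snoc_iff:
  "as @ [x] \<in> source_paths R \<longleftrightarrow>
    (if as = [] then x \<notin> Range R else as \<in> source_paths R \<and> (last as, x) \<in> R)"
proof (cases "as = []")
  case False
  have "(\<forall>i. Suc i < length (as @ [x]) \<longrightarrow> ((as @ [x]) ! i, (as @ [x]) ! Suc i) \<in> R) \<longleftrightarrow>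
    (\<forall>i. Suc i < length as \<longrightarrow> (as ! i, as ! Suc i) \<in> R) \<and> (last as, x) \<in> R" (is "?L \<longleftrightarrow> ?R")
  proof
    assume L: ?L
    have "(as ! i, as ! Suc i) \<in> R" if "Suc i < length as" for i
      using spec[OF L, of i] that by (auto simp: nth_append)
    moreover have "(last as, x) \<in> R"
      using spec[OF L, of "length as - 1"] False by (auto simp: nth_append last_conv_nth)
    ultimately show ?R by auto
  next
    assume R: ?R
    show ?L
    proof safe
      fix i assume "Suc i < length (as @ [x])"
      then consider "Suc i < length as" | "i = length as - 1" by fastforce
      then show "((as @ [x]) ! i, (as @ [x]) ! Suc i) \<in> R"
        by cases (use R False in \<open>auto simp: nth_append last_conv_nth\<close>)
    qed
  qed
  with False show ?thesis by (auto simp: source_paths_def)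
qed (auto simp: source_paths_def)

lemma source_paths_unique:
  assumes "single_valued (R\<inverse>)" "as \<in> source_paths R" "bs \<in> source_paths R" "last as = last bs"
  shows "as = bs"
  using assms(2-4)
proof (induction as arbitrary: bs rule: rev_induct)
  case Nil
  then show ?case by (simp add: source_paths_def)
next
  case (snoc x as)
  obtain bs' where bs: "bs = bs' @ [x]"
    using snoc.prems by (cases bs rule: rev_cases) (auto simp: source_paths_def)
  have "as = [] \<longleftrightarrow> bs' = []"
    using snoc.prems(1,2) unfolding bs source_paths_snoc_iff by (auto split: if_splits)
  moreover have "as = bs'" if "as \<noteq> []" "bs' \<noteq> []"
  proof (rule snoc.IH)
    have *: "as \<in> source_paths R" "(last as, x) \<in> R" "bs' \<in> source_paths R" "(last bs', x) \<in> R"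
      using snoc.prems(1,2) that unfolding bs source_paths_snoc_iff by auto
    then show "as \<in> source_paths R" "bs' \<in> source_paths R" "last as = last bs'"
      using assms(1) by (auto simp: single_valued_def)
  qed
  ultimately show ?case using bs by auto
qed

lemma source_path_exists:
  assumes "wf R"
  shows "\<exists>as\<in>source_paths R. last as = x"
  using assms
proof (induction x rule: wf_induct_rule)
  case (less x)
  show ?case
  proof (cases "x \<in> Range R")
    case True
    then obtain y where y: "(y, x) \<in> R" by auto
    then obtain as where "as \<in> source_paths R" "last as = y" using less by blast
    then have "as @ [x] \<in> source_paths R"
      using y source_paths_snoc_iff[of as x R] by (auto simp: source_paths_def)
    then show ?thesis by (metis last_snoc)
  next
    case False
    then have "[x] \<in> source_paths R" by (simp add: source_paths_def)
    then show ?thesis by (metis last.simps)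
  qed
qed

lemma source_path_distinct:
  assumes "acyclic R" "as \<in> source_paths R"
  shows "distinct as"
proof -
  have "as ! i \<noteq> as ! j" if "i < j" "j < length as" for i j
  proof
    assume eq: "as ! i = as ! j"
    have step: "(as ! k, as ! Suc k) \<in> R" if "Suc k < length as" for k
      using assms(2) that by (auto simp: source_paths_def)
    have "(as ! i, as ! Suc i) \<in> R" using step that by simp
    moreover have "(as ! Suc i, as ! j) \<in> R\<^sup>*"
      using that by (intro chain_nth_reachable step) auto
    ultimately have "(as ! i, as ! i) \<in> R\<^sup>+" using eq by simp
    then show False using assms(1) by (auto simp: acyclic_def)
  qed
  then show ?thesis by (metis distinct_conv_nth linorder_neqE_nat)
qed

text \<open>A path that is maximal at both ends is closed under successors and predecessors, since
  both are unique. Hence it exhausts its connected component.\<close>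

lemma source_path_component:
  assumes "single_valued R" "single_valued (R\<inverse>)" "as \<in> source_paths R" "last as \<notin> Domain R"
  shows "set as = (R \<union> R\<inverse>)\<^sup>* `` {last as}"
proof
  have ne: "as \<noteq> []" and step: "\<And>k. Suc k < length as \<Longrightarrow> (as ! k, as ! Suc k) \<in> R"
    and src: "hd as \<notin> Range R"
    using assms(3) by (auto simp: source_paths_def)
  \<comment> \<open>Symmetry is needed because the component is taken from the last point, where the path ends.\<close>
  have sym: "((R \<union> R\<inverse>)\<^sup>*)\<inverse> = (R \<union> R\<inverse>)\<^sup>*"
    by (simp add: rtrancl_converse[symmetric] converse_Un Un_commute)
  have "R\<^sup>* \<subseteq> (R \<union> R\<inverse>)\<^sup>*" by (rule rtrancl_mono) simp
  have "(last as, a) \<in> (R \<union> R\<inverse>)\<^sup>*" if "a \<in> set as" for a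
  proof -
    obtain i where i: "i < length as" "a = as ! i" using \<open>a \<in> set as\<close> by (metis in_set_conv_nth)
    then have "(a, last as) \<in> R\<^sup>*"
      using ne step by (auto simp: last_conv_nth intro!: chain_nth_reachable)
    then have "(last as, a) \<in> ((R \<union> R\<inverse>)\<^sup>*)\<inverse>" using \<open>R\<^sup>* \<subseteq> (R \<union> R\<inverse>)\<^sup>*\<close> by blast
    then show ?thesis by (simp only: sym)
  qed
  then show "set as \<subseteq> (R \<union> R\<inverse>)\<^sup>* `` {last as}" by blast
  have "b \<in> set as" if "(last as, b) \<in> (R \<union> R\<inverse>)\<^sup>*" for b
    using that
  proof (induction rule: rtrancl_induct)
    case base
    then show ?case using ne by simp
  next
    case (step b c)
    obtain i where i: "i < length as" "b = as ! i" using step.IH by (metis in_set_conv_nth)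
    from step.hyps(2) show ?case
    proof
      assume bc: "(b, c) \<in> R"
      have "Suc i < length as"
      proof (rule ccontr)
        assume "\<not> Suc i < length as"
        with i have "i = length as - 1" by simp
        then have "b = last as" using i ne by (simp add: last_conv_nth)
        then show False using bc assms(4) by auto
      qed
      moreover from this have "c = as ! Suc i"
        using bc i \<open>\<And>k. Suc k < length as \<Longrightarrow> (as ! k, as ! Suc k) \<in> R\<close>[of i] assms(1)
        by (auto simp: single_valued_def)
      ultimately show ?thesis by simp
    next
      assume "(b, c) \<in> R\<inverse>"
      then have cb: "(c, b) \<in> R" by simp
      have "i \<noteq> 0"
      proof
        assume "i = 0"
        then have "b = hd as" using i ne by (simp add: hd_conv_nth)
        then show False using cb src by auto
      qed
      then obtain j where j: "i = Suc j" by (cases i) auto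
      then have "(as ! j, b) \<in> R"
        using i \<open>\<And>k. Suc k < length as \<Longrightarrow> (as ! k, as ! Suc k) \<in> R\<close>[of j] by simp
      then have "c = as ! j" using cb assms(2) by (auto simp: single_valued_def)
      then show ?thesis using i j by simp
    qed
  qed
  then show "(R \<union> R\<inverse>)\<^sup>* `` {last as} \<subseteq> set as" by blast
qed

text \<open>A chain is determined by its last point, and every point outside the domain is the last
  point of a chain.\<close>

lemma card_chain_decomposition:
  assumes "\<alpha> \<in> nilpotents m"
  shows "card (chain_decomposition m \<alpha>) = card ({1..m} - dom \<alpha>)"
proof -
  let ?R = "arrows \<alpha>"
  have "?R \<in> acyclic_injections {1..m}"
    using assms bij_betw_arrows_nilpotents[of m] by (auto simp: bij_betw_def)
  then have R: "?R \<subseteq> {1..m} \<times> {1..m}" "single_valued ?R" "single_valued (?R\<inverse>)" "acyclic ?R"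
    by (auto simp: injections_defs)
  have fin: "finite ?R" using R(1) by (rule finite_subset) simp
  have paths: "as \<in> source_paths ?R" "last as \<in> {1..m} - dom \<alpha>"
    if as: "as \<in> chain_decomposition m \<alpha>" for as
  proof -
    show "as \<in> source_paths ?R" using as by (simp add: chain_decomposition_def source_paths_def)
    obtain x where x: "x \<in> {1..m}" "set as = (?R \<union> ?R\<inverse>)\<^sup>* `` {x}"
      using as unfolding chain_decomposition_def components_def mem_Collect_eq
      by (elim conjE) (erule quotientE, blast)
    have "(?R \<union> ?R\<inverse>)\<^sup>+ \<subseteq> {1..m} \<times> {1..m}" using R(1) by (intro trancl_subset_Sigma) auto
    with x have "set as \<subseteq> {1..m}" by (auto simp: rtrancl_eq_or_trancl)
    then show "last as \<in> {1..m} - dom \<alpha>"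
      using as last_in_set[of as] unfolding chain_decomposition_def mem_Collect_eq by blast
  qed
  have "bij_betw last (chain_decomposition m \<alpha>) ({1..m} - dom \<alpha>)"
    unfolding bij_betw_def
  proof
    show "inj_on last (chain_decomposition m \<alpha>)"
      using source_paths_unique[OF R(3)] paths(1) by (auto intro!: inj_onI)
    show "last ` chain_decomposition m \<alpha> = {1..m} - dom \<alpha>"
    proof
      show "last ` chain_decomposition m \<alpha> \<subseteq> {1..m} - dom \<alpha>" using paths(2) by blast
      show "{1..m} - dom \<alpha> \<subseteq> last ` chain_decomposition m \<alpha>"
      proof
        fix x assume x: "x \<in> {1..m} - dom \<alpha>"
        obtain as where as: "as \<in> source_paths ?R" "last as = x"
          using source_path_exists[OF finite_acyclic_wf[OF fin R(4)]] by blast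
        have "set as = (?R \<union> ?R\<inverse>)\<^sup>* `` {x}"
          using source_path_component[OF R(2,3) as(1)] as(2) x by auto
        then have "set as \<in> components m \<alpha>"
          using x by (auto simp: components_def intro: quotientI)
        then have "as \<in> chain_decomposition m \<alpha>"
          using as x source_path_distinct[OF R(4) as(1)]
          by (auto simp: chain_decomposition_def source_paths_def)
        with as(2) show "x \<in> last ` chain_decomposition m \<alpha>" by blast
      qed
    qed
  qed
  then show ?thesis by (rule bij_betw_same_card)
qed

lemma total_chains_eq_sum_terminal:
  "total_chains m = (\<Sum>R\<in>acyclic_injections {1..m}. card ({1..m} - Domain R))"
proof -
  have "total_chains m = (\<Sum>\<alpha>\<in>nilpotents m. card ({1..m} - Domain (arrows \<alpha>)))"
    by (simp add: total_chains_def card_chain_decomposition)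
  also have "\<dots> = (\<Sum>R\<in>acyclic_injections {1..m}. card ({1..m} - Domain R))"
    by (rule sum.reindex_bij_betw[OF bij_betw_arrows_nilpotents])
  finally show ?thesis .
qed

text \<open>Both sides count the nilpotent maps on one more point, here \<open>0\<close>, that are undefined at the
  new point.\<close>

lemma total_chains_plus_card_nilpotents:
  "total_chains m + card (nilpotents m) = card (partial_injections {1..m})"
proof -
  have "card (nilpotents m) = card (acyclic_injections {1..m})"
    by (rule bij_betw_same_card[OF bij_betw_arrows_nilpotents])
  then have "total_chains m + card (nilpotents m) =
      card {R \<in> acyclic_injections (insert 0 {1..m}). 0 \<notin> Domain R}"
    using card_terminal_insert[of "{1..m}" 0] sum_card_terminal[of "{1..m}"]
      total_chains_eq_sum_terminal[of m] by simp
  also have "\<dots> = card (partial_injections {1..m})"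
    using card_terminal[of "insert 0 {1..m}" 0] by simp
  finally show ?thesis .
qed

section \<open>The three counts\<close>

lemma orbit_count_zero:
  assumes "n \<ge> 1"
  shows "orbit_count n 0 = card (sym_inv_semigroup (n - 1))"
proof -
  have "orbit_count n 0 = card {R \<in> acyclic_injections {1..n}. 1 \<notin> Domain R}"
    unfolding orbit_count_def
  proof (rule card_nilpotents_Collect)
    fix \<alpha> assume "\<alpha> \<in> nilpotents n"
    then have R: "arrows \<alpha> \<in> acyclic_injections {1..n}"
      using bij_betw_arrows_nilpotents[of n] by (auto simp: bij_betw_def)
    have "finite ((arrows \<alpha>)\<^sup>* `` {1})"
      by (rule finite_rtrancl_Image) (use acyclic_injection_finite[OF _ R] in auto)
    then have "card ((arrows \<alpha>)\<^sup>* `` {1}) \<noteq> 0" by auto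
    then show "1 \<notin> Domain (arrows \<alpha>) \<longleftrightarrow> card (orbit \<alpha> 1) = 0"
      by (simp add: orbit_eq_reachable)
  qed
  also have "\<dots> = card (partial_injections ({1..n} - {1}))"
    using assms by (intro card_terminal) auto
  also have "\<dots> = card (partial_injections {1..n - 1})"
    using assms by (intro card_partial_injections_cong) auto
  also have "\<dots> = card (sym_inv_semigroup (n - 1))"
    by (rule bij_betw_same_card[OF bij_betw_arrows, symmetric])
  finally show ?thesis .
qed

lemma card_nilpotents_singleton_chain:
  assumes "n \<ge> 1"
  shows "card {\<alpha> \<in> nilpotents n. [1] \<in> chain_decomposition n \<alpha>} = card (nilpotents (n - 1))"
proof -
  have "insert 1 ({1..n} - {1}) = {1..n}" using assms by auto
  note iso = acyclic_injections_isolated[of 1 "{1..n} - {1}", unfolded this]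
  have "card {\<alpha> \<in> nilpotents n. [1] \<in> chain_decomposition n \<alpha>} =
      card {R \<in> acyclic_injections {1..n}. 1 \<notin> Domain R \<and> 1 \<notin> Range R}"
    using assms by (intro card_nilpotents_Collect) (simp add: singleton_chain_iff)
  also have "\<dots> = card (acyclic_injections ({1..n} - {1}))" using iso by simp
  also have "\<dots> = card (acyclic_injections {1..n - 1})"
    using assms by (intro card_acyclic_injections_cong) auto
  also have "\<dots> = card (nilpotents (n - 1))"
    by (rule bij_betw_same_card[OF bij_betw_arrows_nilpotents, symmetric])
  finally show ?thesis .
qed

lemma orbit_count_gt_one:
  assumes "1 < k" "k \<le> n"
  shows "orbit_count n k =
    dec_factorial (n - 1) (k - 1) * (total_chains (n - k) + card (nilpotents (n - k)))"
proof -
  have "orbit_count n k = card {R \<in> acyclic_injections {1..n}. card (R\<^sup>* `` {1}) = k}"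
    unfolding orbit_count_def
  proof (rule card_nilpotents_Collect)
    fix \<alpha>
    have "(arrows \<alpha>)\<^sup>* `` {1} = {1}" if "1 \<notin> dom \<alpha>"
      using that by (auto elim: converse_rtranclE)
    then show "card ((arrows \<alpha>)\<^sup>* `` {1}) = k \<longleftrightarrow> card (orbit \<alpha> 1) = k"
      using assms(1) by (auto simp: orbit_eq_reachable)
  qed
  also have "\<dots> = dec_factorial (n - 1) (k - 1) * card (partial_injections {1..n - k})"
    using card_reachable[of "{1..n}" 1 "{1..n - k}" "k - 1"] assms by simp
  finally show ?thesis by (simp only: total_chains_plus_card_nilpotents)
qed

theorem theorem5:
  fixes n :: nat
  assumes "n \<ge> 1"
  shows "orbit_count n 0 = card (sym_inv_semigroup (n - 1)) \<and>
    card {\<alpha> \<in> nilpotents n. [1] \<in> chain_decomposition n \<alpha>} = card (nilpotents (n - 1)) \<and>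
    (\<forall>k. 1 < k \<and> k \<le> n \<longrightarrow>
      orbit_count n k =
        dec_factorial (n - 1) (k - 1) * (total_chains (n - k) + card (nilpotents (n - k))))"
  using orbit_count_zero[OF assms] card_nilpotents_singleton_chain[OF assms] orbit_count_gt_one
  by blast

end
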